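(* Let $f=h+\overline{g}\in\mathcal{H_R}$ be a sense-preserving harmonic mapping. Then, for $z\in\mathbb{D}$ with $|z|=r$, the inequalities $$\frac{1}{1+r}\le|h'(z)|\le\frac{1}{1-r}\quad\text{and}\quad 0\le|g'(z)|\le\frac{1}{1-r}$$ hold. These inequalities are sharp, i.e. for each $r\in(0,1)$ none of the four bounds can be improved over all $f\in\mathcal{H_R}$ and all $z$ with $|z|=r$.
   Context: Let $\mathbb{D}=\{z\in\mathbb{C}:|z|<1\}$. $\mathcal{A}$ is the class of analytic functions $h$ in $\mathbb{D}$ with $h(0)=0$, $h'(0)=1$. $\mathcal{H}$ is the class of all sense-preserving harmonic functions $f=h+\overline{g}$ in $\mathbb{D}$, with $h,g$ analytic in $\mathbb{D}$ of the form $h(z)=z+\sum_{n=2}^\infty a_nz^n$, $g(z)=\sum_{n=1}^\infty b_nz^n$; sense-preserving means that the Jacobian $J_f=|h'|^2-|g'|^2$ is positive in $\mathbb{D}$. $\mathcal{R}$ is the class of functions $h\in\mathcal{A}$ such that, for some $m\in\mathbb{N}=\{1,2,3,\dots\}$, $h'(z)=\frac{m}{m-z^m}$ for all $z\in\mathbb{D}$. $\mathcal{H_R}$ is the class of all $f=h+\overline{g}\in\mathcal{H}$ with $h\in\mathcal{R}$. *)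

theory Defs
  imports "HOL-Complex_Analysis.Complex_Analysis"
begin

text \<open>Members of the function classes below are total functions on the complex plane of which
  only the values on the unit disc are constrained; as the disc is open, \<^term>\<open>deriv\<close> at
  a point of the disc depends on those values only.\<close>

abbreviation unit_disc :: "complex set"
  where "unit_disc \<equiv> ball 0 1"

definition class_A :: "(complex \<Rightarrow> complex) set" where
  "class_A = {h. h holomorphic_on unit_disc \<and> h 0 = 0 \<and> deriv h 0 = 1}"

definition class_R :: "(complex \<Rightarrow> complex) set" where
  "class_R = {h \<in> class_A. \<exists>m::nat. m \<ge> 1 \<and>
     (\<forall>z\<in>unit_disc. deriv h z = of_nat m / (of_nat m - z ^ m))}"

text \<open>The function \<open>f\<close> is \<open>h\<close> plus the conjugate of \<open>g\<close> on the disc, where \<open>h\<close> has a power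
  series z + a(2) z^2 + a(3) z^3 + ... and \<open>g\<close> a power series b(1) z + b(2) z^2 + ...;
  the indices are shifted so that both sums start at 0.\<close>

definition harmonic_decomp ::
  "(complex \<Rightarrow> complex) \<Rightarrow> (complex \<Rightarrow> complex) \<Rightarrow> (complex \<Rightarrow> complex) \<Rightarrow> bool" where
  "harmonic_decomp f h g \<longleftrightarrow>
     h holomorphic_on unit_disc \<and> g holomorphic_on unit_disc \<and>
     (\<exists>a. \<forall>z\<in>unit_disc. (\<lambda>n. a (n + 2) * z ^ (n + 2)) sums (h z - z)) \<and>
     (\<exists>b. \<forall>z\<in>unit_disc. (\<lambda>n. b (n + 1) * z ^ (n + 1)) sums g z) \<and>
     (\<forall>z\<in>unit_disc. f z = h z + cnj (g z))"

definition jacobian :: "(complex \<Rightarrow> complex) \<Rightarrow> (complex \<Rightarrow> complex) \<Rightarrow> complex \<Rightarrow> real" where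
  "jacobian h g z = (cmod (deriv h z))\<^sup>2 - (cmod (deriv g z))\<^sup>2"

definition class_H :: "(complex \<Rightarrow> complex) set" where
  "class_H = {f. \<exists>h g. harmonic_decomp f h g \<and> (\<forall>z\<in>unit_disc. jacobian h g z > 0)}"

text \<open>The decomposition of a given \<open>f\<close> is unique on the disc, so the existential quantifier
  here and the one in \<^const>\<open>class_H\<close> speak about the same \<open>h\<close> and \<open>g\<close>.\<close>

definition class_HR :: "(complex \<Rightarrow> complex) set" where
  "class_HR = {f \<in> class_H. \<exists>h g. harmonic_decomp f h g \<and> h \<in> class_R}"

end

theory Submission imports Defs begin

text \<open>For \<open>h \<in> \<R>\<close> the growth bounds follow from \<open>|z ^ m| \<le> |z| \<le> m |z|\<close> and the triangle
  inequality, and a positive Jacobian passes the upper bound on to \<open>g'\<close>. Both bounds on \<open>h'\<close> are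
  attained for \<open>m = 1\<close>, that is by \<open>h z = - Ln (1 - z)\<close>, at \<open>z = \<plusminus>r\<close>. The pairs \<open>(h, k h)\<close> with
  \<open>0 \<le> k < 1\<close> show that the bounds on \<open>g'\<close> cannot be improved, the upper one as \<open>k\<close> tends to 1.\<close>

text \<open>The derivative of \<open>H\<close> at \<open>z\<close> is complex linear, while that of
  the conjugate of \<open>G\<close> is antilinear; a real-linear map that is both must
  vanish.\<close>

lemma deriv_zero_if_eq_cnj:
  fixes H G :: "complex \<Rightarrow> complex"
  assumes "H holomorphic_on S" "G holomorphic_on S" "open S" "z \<in> S"
    and eq: "\<And>w. w \<in> S \<Longrightarrow> H w = cnj (G w)"
  shows "deriv H z = 0" and "deriv G z = 0"
proof -
  have "(H has_derivative (\<lambda>x. deriv H z * x)) (at z)"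
    using assms holomorphic_derivI has_field_derivative_imp_has_derivative by blast
  moreover have "(H has_derivative (\<lambda>x. cnj (deriv G z * x))) (at z)"
  proof (rule has_derivative_transform_within_open)
    show "((\<lambda>w. cnj (G w)) has_derivative (\<lambda>x. cnj (deriv G z * x))) (at z)"
      using assms holomorphic_derivI has_field_derivative_imp_has_derivative
      by (intro has_derivative_cnj) blast
  qed (use assms in auto)
  ultimately have "(\<lambda>x. deriv H z * x) = (\<lambda>x. cnj (deriv G z * x))"
    by (rule has_derivative_unique)
  then have eq': "deriv H z * x = cnj (deriv G z * x)" for x
    by metis
  show "deriv H z = 0"
    \<comment> \<open>The direction 1 gives \<open>deriv H z = cnj (deriv G z)\<close>, and the
      direction \<i> gives the same equation with the opposite sign.\<close>
    using eq'[of 1] eq'[of \<i>] by (simp add: complex_eq_iff)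
  show "deriv G z = 0"
    using eq'[of 1] eq'[of \<i>] by (simp add: complex_eq_iff)
qed

text \<open>Subtracting two decompositions of \<open>f\<close> leaves an analytic function equal to
  the conjugate of an analytic one, so both differences have derivative 0. Only derivatives enter
  the bounds and the Jacobian, so uniqueness at this level suffices.\<close>

lemma harmonic_decomp_deriv_unique:
  assumes "harmonic_decomp f h g" "harmonic_decomp f h' g'" "z \<in> unit_disc"
  shows "deriv h z = deriv h' z" and "deriv g z = deriv g' z"
proof -
  have hol: "h holomorphic_on unit_disc" "g holomorphic_on unit_disc"
      "h' holomorphic_on unit_disc" "g' holomorphic_on unit_disc"
    using assms by (auto simp: harmonic_decomp_def)
  have eq: "h w - h' w = cnj (g' w - g w)" if "w \<in> unit_disc" for w
  proof -
    have "h w + cnj (g w) = h' w + cnj (g' w)"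
      using assms that unfolding harmonic_decomp_def by metis
    then show ?thesis
      by (simp add: algebra_simps)
  qed
  have diff_hol: "(\<lambda>w. h w - h' w) holomorphic_on unit_disc" "(\<lambda>w. g' w - g w) holomorphic_on unit_disc"
    using hol by (auto intro!: holomorphic_intros)
  note zero = deriv_zero_if_eq_cnj[OF diff_hol open_ball assms(3) eq]
  have diff: "u field_differentiable at z" if "u holomorphic_on unit_disc" for u
    using that assms(3) holomorphic_on_imp_differentiable_at by blast
  show "deriv h z = deriv h' z" and "deriv g z = deriv g' z"
    using zero diff hol by simp_all
qed

text \<open>Membership in \<open>class_HR\<close> supplies two decompositions, one with
  \<open>h\<close> in \<open>class_R\<close> and one with positive Jacobian. Uniqueness of the
  derivatives carries both properties over to the given pair.\<close>

lemma class_HR_decomp: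
  assumes "f \<in> class_HR" "harmonic_decomp f h g" "z \<in> unit_disc"
  shows "\<exists>m\<ge>1. deriv h z = of_nat m / (of_nat m - z ^ m)"
    and "cmod (deriv g z) < cmod (deriv h z)"
proof -
  obtain h' g' where "harmonic_decomp f h' g'" "h' \<in> class_R"
    using assms(1) by (auto simp: class_HR_def)
  then show "\<exists>m\<ge>1. deriv h z = of_nat m / (of_nat m - z ^ m)"
    using harmonic_decomp_deriv_unique[OF assms(2) _ assms(3)] assms(3)
    by (auto simp: class_R_def)
  obtain h'' g'' where dec: "harmonic_decomp f h'' g''" and "jacobian h'' g'' z > 0"
    using assms(1,3) by (auto simp: class_HR_def class_H_def)
  then have "(cmod (deriv g z))\<^sup>2 < (cmod (deriv h z))\<^sup>2"
    using harmonic_decomp_deriv_unique[OF assms(2) dec assms(3)] by (simp add: jacobian_def)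
  then show "cmod (deriv g z) < cmod (deriv h z)"
    by (rule power2_less_imp_less) simp
qed

lemma cmod_class_R_deriv_bounds:
  fixes z :: complex
  assumes "m \<ge> 1" "cmod z < 1"
  shows "1 / (1 + cmod z) \<le> cmod (of_nat m / (of_nat m - z ^ m))"
    and "cmod (of_nat m / (of_nat m - z ^ m)) \<le> 1 / (1 - cmod z)"
proof -
  have "cmod z ^ m \<le> cmod z"
    using power_decreasing[of 1 m "cmod z"] assms by simp
  \<comment> \<open>The weaker bound with the factor \<open>m\<close> makes \<open>m\<close> cancel
    in the quotients below, so the final bounds are uniform in \<open>m\<close>.\<close>
  also have "\<dots> \<le> real m * cmod z"
    using mult_right_mono[of 1 "real m" "cmod z"] assms by simp
  finally have pow: "cmod (z ^ m) \<le> real m * cmod z"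
    by (simp add: norm_power)
  have upper: "cmod (of_nat m - z ^ m) \<le> real m * (1 + cmod z)"
    using norm_triangle_ineq4[of "of_nat m" "z ^ m"] pow by (simp add: algebra_simps)
  have lower: "real m * (1 - cmod z) \<le> cmod (of_nat m - z ^ m)"
    using norm_triangle_ineq2[of "of_nat m" "z ^ m"] pow by (simp add: algebra_simps)
  have pos: "0 < real m * (1 - cmod z)"
    using assms by simp
  note denom_pos = less_le_trans[OF pos lower]
  have "1 / (1 + cmod z) = real m / (real m * (1 + cmod z))"
    using assms by simp
  also have "\<dots> \<le> real m / cmod (of_nat m - z ^ m)"
    by (rule divide_left_mono[OF upper _ mult_pos_pos[OF less_le_trans[OF denom_pos upper] denom_pos]]) simp
  finally show "1 / (1 + cmod z) \<le> cmod (of_nat m / (of_nat m - z ^ m))"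
    by (simp add: norm_divide)
  have "real m / cmod (of_nat m - z ^ m) \<le> real m / (real m * (1 - cmod z))"
    by (rule divide_left_mono[OF lower _ mult_pos_pos[OF denom_pos pos]]) simp
  also have "\<dots> = 1 / (1 - cmod z)"
    using assms by simp
  finally show "cmod (of_nat m / (of_nat m - z ^ m)) \<le> 1 / (1 - cmod z)"
    by (simp add: norm_divide)
qed

text \<open>The required series are the Taylor series at 0, with the leading terms fixed by the
  normalisation.\<close>

lemma harmonic_decompI:
  assumes "h \<in> class_A" "g holomorphic_on unit_disc" "g 0 = 0"
  shows "harmonic_decomp (\<lambda>z. h z + cnj (g z)) h g"
proof -
  have h: "h holomorphic_on unit_disc" "h 0 = 0" "deriv h 0 = 1"
    using assms(1) by (auto simp: class_A_def)
  define a where "a n = (deriv ^^ n) h 0 / fact n" for n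
  define b where "b n = (deriv ^^ n) g 0 / fact n" for n
  have "(\<lambda>n. a (n + 2) * z ^ (n + 2)) sums (h z - z)" if "z \<in> unit_disc" for z
  proof -
    have "(\<lambda>n. a n * z ^ n) sums h z"
      using holomorphic_power_series[OF h(1) that] by (simp add: a_def)
    then show ?thesis
      \<comment> \<open>The two terms split off are \<open>h 0 = 0\<close> and
        \<open>deriv h 0 * z = z\<close>; they turn the sum \<open>h z\<close> into
        \<open>h z - z\<close>.\<close>
      unfolding sums_iff_shift[of "\<lambda>n. a n * z ^ n" 2 "h z - z"]
      using h by (simp add: a_def numeral_2_eq_2)
  qed
  moreover have "(\<lambda>n. b (n + 1) * z ^ (n + 1)) sums g z" if "z \<in> unit_disc" for z
  proof -
    have "(\<lambda>n. b n * z ^ n) sums g z"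
      using holomorphic_power_series[OF assms(2) that] by (simp add: b_def)
    then show ?thesis
      unfolding sums_iff_shift[of "\<lambda>n. b n * z ^ n" 1 "g z"]
      using assms(3) by (simp add: b_def)
  qed
  ultimately show ?thesis
    using h(1) assms(2) unfolding harmonic_decomp_def by blast
qed

lemma has_field_derivative_neg_Ln_one_minus:
  assumes "z \<in> unit_disc"
  shows "((\<lambda>z. - Ln (1 - z)) has_field_derivative 1 / (1 - z)) (at z)"
proof -
  \<comment> \<open>Thus \<open>1 - z\<close> has positive real part and avoids the branch cut of
    \<open>Ln\<close>.\<close>
  have "Re z < 1"
    using assms complex_Re_le_cmod[of z] by simp
  then have "1 - z \<notin> \<real>\<^sub>\<le>\<^sub>0"
    by (auto simp: complex_nonpos_Reals_iff)
  moreover from this have "1 - z \<noteq> 0"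
    by auto
  ultimately show ?thesis
    by (auto intro!: derivative_eq_intros simp: field_simps)
qed

lemma neg_Ln_one_minus_in_class_R: "(\<lambda>z. - Ln (1 - z)) \<in> class_R"
proof -
  have deriv: "deriv (\<lambda>z. - Ln (1 - z)) z = 1 / (1 - z)" if "z \<in> unit_disc" for z
    using has_field_derivative_neg_Ln_one_minus[OF that] by (rule DERIV_imp_deriv)
  have "(\<lambda>z. - Ln (1 - z)) holomorphic_on unit_disc"
    using has_field_derivative_neg_Ln_one_minus holomorphic_on_open[OF open_ball] by blast
  then show ?thesis
    using deriv by (auto simp: class_R_def class_A_def intro!: exI[of _ "1::nat"])
qed

text \<open>Here \<open>g' = k h'\<close> with constant dilatation \<open>k\<close>, so the Jacobian
  is \<open>(1 - k^2) |h'|^2\<close>, which is positive because \<open>k < 1\<close>. The case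
  \<open>k = 0\<close> gives an analytic \<open>f\<close>.\<close>

lemma extremal_family:
  assumes "0 \<le> k" "k < 1"
  obtains f h g where "f \<in> class_HR" "harmonic_decomp f h g"
    "\<And>z. z \<in> unit_disc \<Longrightarrow> deriv h z = 1 / (1 - z)"
    "\<And>z. z \<in> unit_disc \<Longrightarrow> deriv g z = complex_of_real k / (1 - z)"
proof -
  define h where "h = (\<lambda>z. - Ln (1 - z))"
  define g where "g = (\<lambda>z. complex_of_real k * h z)"
  have R: "h \<in> class_R"
    using neg_Ln_one_minus_in_class_R by (simp add: h_def)
  then have A: "h \<in> class_A"
    by (simp add: class_R_def)
  then have hol: "h holomorphic_on unit_disc" and "h 0 = 0"
    by (auto simp: class_A_def)
  have h': "deriv h z = 1 / (1 - z)" if "z \<in> unit_disc" for z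
    using has_field_derivative_neg_Ln_one_minus[OF that] unfolding h_def by (rule DERIV_imp_deriv)
  have g': "deriv g z = complex_of_real k / (1 - z)" if "z \<in> unit_disc" for z
    using DERIV_cmult[OF has_field_derivative_neg_Ln_one_minus[OF that], of "complex_of_real k"]
    by (auto simp: g_def h_def intro!: DERIV_imp_deriv)
  have dec: "harmonic_decomp (\<lambda>z. h z + cnj (g z)) h g"
    using A \<open>h 0 = 0\<close> hol by (intro harmonic_decompI) (auto simp: g_def intro!: holomorphic_intros)
  have "jacobian h g z > 0" if "z \<in> unit_disc" for z
  proof -
    have "z \<noteq> 1"
      using that by auto
    then have "cmod (deriv g z) < cmod (deriv h z)"
      using assms by (simp add: h'[OF that] g'[OF that] norm_divide divide_strict_right_mono)
    then show ?thesis
      by (simp add: jacobian_def power_strict_mono)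
  qed
  then have "(\<lambda>z. h z + cnj (g z)) \<in> class_HR"
    using dec R unfolding class_HR_def class_H_def by blast
  then show ?thesis
    using that dec h' g' by blast
qed

theorem theorem2p4:
  shows "(\<forall>f\<in>class_HR. \<forall>h g. harmonic_decomp f h g \<longrightarrow>
           (\<forall>(z::complex) (r::real). z \<in> unit_disc \<and> cmod z = r \<longrightarrow>
              1 / (1 + r) \<le> cmod (deriv h z) \<and> cmod (deriv h z) \<le> 1 / (1 - r) \<and>
              0 \<le> cmod (deriv g z) \<and> cmod (deriv g z) \<le> 1 / (1 - r))) \<and>
         (\<forall>r::real. 0 < r \<and> r < 1 \<longrightarrow>
           (\<forall>c::real. (\<forall>f\<in>class_HR. \<forall>h g. harmonic_decomp f h g \<longrightarrow>
                (\<forall>z. cmod z = r \<longrightarrow> c \<le> cmod (deriv h z))) \<longrightarrow> c \<le> 1 / (1 + r)) \<and>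
           (\<forall>c::real. (\<forall>f\<in>class_HR. \<forall>h g. harmonic_decomp f h g \<longrightarrow>
                (\<forall>z. cmod z = r \<longrightarrow> cmod (deriv h z) \<le> c)) \<longrightarrow> 1 / (1 - r) \<le> c) \<and>
           (\<forall>c::real. (\<forall>f\<in>class_HR. \<forall>h g. harmonic_decomp f h g \<longrightarrow>
                (\<forall>z. cmod z = r \<longrightarrow> c \<le> cmod (deriv g z))) \<longrightarrow> c \<le> 0) \<and>
           (\<forall>c::real. (\<forall>f\<in>class_HR. \<forall>h g. harmonic_decomp f h g \<longrightarrow>
                (\<forall>z. cmod z = r \<longrightarrow> cmod (deriv g z) \<le> c)) \<longrightarrow> 1 / (1 - r) \<le> c))"
proof (intro conjI ballI allI impI)
  fix f h g and z :: complex and r :: real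
  assume f: "f \<in> class_HR" "harmonic_decomp f h g" and z: "z \<in> unit_disc \<and> cmod z = r"
  obtain m where m: "m \<ge> 1" "deriv h z = of_nat m / (of_nat m - z ^ m)"
    using class_HR_decomp(1) f z by blast
  show "1 / (1 + r) \<le> cmod (deriv h z)" and upper: "cmod (deriv h z) \<le> 1 / (1 - r)"
    using cmod_class_R_deriv_bounds[OF m(1), of z] m(2) z by auto
  show "0 \<le> cmod (deriv g z)"
    by simp
  show "cmod (deriv g z) \<le> 1 / (1 - r)"
    using class_HR_decomp(2)[OF f] z upper by fastforce
next
  fix r c :: real
  assume r: "0 < r \<and> r < 1"
    and c: "\<forall>f\<in>class_HR. \<forall>h g. harmonic_decomp f h g \<longrightarrow>
      (\<forall>z. cmod z = r \<longrightarrow> c \<le> cmod (deriv h z))"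
  obtain f h g where f: "f \<in> class_HR" "harmonic_decomp f h g"
    and h': "\<And>z. z \<in> unit_disc \<Longrightarrow> deriv h z = 1 / (1 - z)"
    by (rule extremal_family[of 0]) auto
  \<comment> \<open>On the circle of radius \<open>r\<close>, \<open>|1 - z|\<close> is largest at
    \<open>z = -r\<close>, which makes \<open>|h'|\<close> smallest there.\<close>
  have "cmod (1 + complex_of_real r) = 1 + r"
    using r by (metis norm_of_real of_real_1 of_real_add abs_of_pos add_pos_pos zero_less_one)
  then show "c \<le> 1 / (1 + r)"
    using c[rule_format, OF f, of "- of_real r"] h'[of "- of_real r"] r by (simp add: norm_divide)
next
  fix r c :: real
  assume r: "0 < r \<and> r < 1"
    and c: "\<forall>f\<in>class_HR. \<forall>h g. harmonic_decomp f h g \<longrightarrow>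
      (\<forall>z. cmod z = r \<longrightarrow> cmod (deriv h z) \<le> c)"
  obtain f h g where f: "f \<in> class_HR" "harmonic_decomp f h g"
    and h': "\<And>z. z \<in> unit_disc \<Longrightarrow> deriv h z = 1 / (1 - z)"
    by (rule extremal_family[of 0]) auto
  \<comment> \<open>At the opposite point \<open>z = r\<close>, \<open>|1 - z|\<close> is smallest
    and \<open>|h'|\<close> largest.\<close>
  have "cmod (1 - complex_of_real r) = 1 - r"
    using r norm_of_real[of "1 - r", where 'a = complex] by simp
  then show "1 / (1 - r) \<le> c"
    using c[rule_format, OF f, of "of_real r"] h'[of "of_real r"] r by (simp add: norm_divide)
next
  fix r c :: real
  assume r: "0 < r \<and> r < 1"
    and c: "\<forall>f\<in>class_HR. \<forall>h g. harmonic_decomp f h g \<longrightarrow>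
      (\<forall>z. cmod z = r \<longrightarrow> c \<le> cmod (deriv g z))"
  obtain f h g where f: "f \<in> class_HR" "harmonic_decomp f h g"
    and g': "\<And>z. z \<in> unit_disc \<Longrightarrow> deriv g z = complex_of_real 0 / (1 - z)"
    by (rule extremal_family[of 0]) auto
  show "c \<le> 0"
    using c[rule_format, OF f, of "of_real r"] g'[of "of_real r"] r by simp
next
  fix r c :: real
  assume r: "0 < r \<and> r < 1"
    and c: "\<forall>f\<in>class_HR. \<forall>h g. harmonic_decomp f h g \<longrightarrow>
      (\<forall>z. cmod z = r \<longrightarrow> cmod (deriv g z) \<le> c)"
  have norm: "cmod (1 - complex_of_real r) = 1 - r"
    using r norm_of_real[of "1 - r", where 'a = complex] by simp
  \<comment> \<open>For \<open>k = 1\<close> the Jacobian would vanish, so this bound is only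
    approached: every \<open>k\<close> below 1 gives an estimate at \<open>z = r\<close>, and
    \<open>c\<close> does not depend on \<open>k\<close>.\<close>
  have le: "k * (1 / (1 - r)) \<le> c" if k: "0 < k" "k < 1" for k
  proof -
    obtain f h g where f: "f \<in> class_HR" "harmonic_decomp f h g"
      and g': "\<And>z. z \<in> unit_disc \<Longrightarrow> deriv g z = complex_of_real k / (1 - z)"
      using extremal_family[of k] k by (metis less_imp_le)
    show ?thesis
      using c[rule_format, OF f, of "of_real r"] g'[of "of_real r"] r k norm
      by (simp add: norm_divide)
  qed
  then show "1 / (1 - r) \<le> c"
    \<comment> \<open>This rule plays the part of the limit as \<open>k\<close> tends to 1.\<close>
    by (rule field_le_mult_one_interval)
qed

end
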